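(* Let $\mathfrak{B}_2$ be the four-element Magari algebra described in the context, with universe $\{\mathbb{0},\rho,\sigma,\mathbb{1}\}$. A function $f:\{\mathbb{0},\rho,\sigma,\mathbb{1}\}^n\to\{\mathbb{0},\rho,\sigma,\mathbb{1}\}$ (a function of the general 4-valued logic) is the operation induced on $\mathfrak{B}_2$ by some formula $F(p_1,\dots,p_n)$ of the propositional provability calculus (i.e. $F[\alpha_1,\dots,\alpha_n]=f(\alpha_1,\dots,\alpha_n)$ for all $\alpha_1,\dots,\alpha_n\in\mathfrak{B}_2$) if and only if $f$ preserves on $\mathfrak{B}_2$ the binary relation $\Delta x=\Delta y$, that is: for all $\alpha_1,\dots,\alpha_n,\beta_1,\dots,\beta_n\in\mathfrak{B}_2$ with $\Delta\alpha_i=\Delta\beta_i$ for every $i=1,\dots,n$, one has $\Delta f(\alpha_1,\dots,\alpha_n)=\Delta f(\beta_1,\dots,\beta_n)$.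
   Context: Formulas of the propositional provability calculus (the calculus of the logic $GL$) are built from propositional variables $p,q,r,\dots$ (possibly indexed) using the connectives $\&,\vee,\supset,\neg$ and the unary modal connective $\Delta$. The constant formulas $p\&\neg p$, $p\supset p$, $\Delta(p\&\neg p)$, $\neg\Delta(p\&\neg p)$ are denoted $0,1,\sigma,\rho$. The algebra $\mathfrak{B}_2=(\{\mathbb{0},\rho,\sigma,\mathbb{1}\};\&,\vee,\supset,\neg,\Delta)$ is the four-element Boolean algebra with least element $\mathbb{0}$, greatest element $\mathbb{1}$ and two atoms $\rho,\sigma$ (so $\neg\rho=\sigma$), with Boolean operations defined as usual, together with the unary operation $\Delta\mathbb{0}=\Delta\rho=\sigma$, $\Delta\sigma=\Delta\mathbb{1}=\mathbb{1}$. A formula is evaluated on $\mathfrak{B}_2$ by interpreting variables as elements and connectives as the corresponding operations; $F[\alpha_1,\dots,\alpha_n]$ denotes the value of $F(p_1,\dots,p_n)$ when $p_i$ takes value $\alpha_i$. The logic $L\mathfrak{B}_2$ is the set of formulas whose value is $\mathbb{1}$ under every evaluation on $\mathfrak{B}_2$. *)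

theory Defs imports Main begin

datatype fm =
    Var nat
  | Conj fm fm
  | Disj fm fm
  | Impl fm fm
  | Neg fm
  | Delta fm

primrec vars :: "fm \<Rightarrow> nat set" where
  "vars (Var i) = {i}"
| "vars (Conj F G) = vars F \<union> vars G"
| "vars (Disj F G) = vars F \<union> vars G"
| "vars (Impl F G) = vars F \<union> vars G"
| "vars (Neg F) = vars F"
| "vars (Delta F) = vars F"

datatype b2 = Zero | Rho | Sigma | One

instantiation b2 :: boolean_algebra
begin

definition "bot = Zero"

definition "top = One"

definition "x \<le> y \<longleftrightarrow> x = Zero \<or> y = One \<or> x = y" for x y :: b2

definition "x < y \<longleftrightarrow> x \<le> y \<and> x \<noteq> y" for x y :: b2

definition "inf x y = (if x \<le> y then x else if y \<le> x then y else Zero)" for x y :: b2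

definition "sup x y = (if x \<le> y then y else if y \<le> x then x else One)" for x y :: b2

definition "- x = (case x of Zero \<Rightarrow> One | Rho \<Rightarrow> Sigma | Sigma \<Rightarrow> Rho | One \<Rightarrow> Zero)" for x :: b2

definition "x - y = inf x (- y)" for x y :: b2

instance
proof
  note defs = bot_b2_def top_b2_def less_eq_b2_def less_b2_def inf_b2_def sup_b2_def
    uminus_b2_def minus_b2_def
  fix x y z :: b2
  show "(x < y) = (x \<le> y \<and> \<not> y \<le> x)" by (cases x; cases y) (simp_all add: defs)
  show "x \<le> x" by (simp add: defs)
  show "x \<le> z" if "x \<le> y" "y \<le> z" using that by (cases x; cases y; cases z) (simp_all add: defs)
  show "x = y" if "x \<le> y" "y \<le> x" using that by (cases x; cases y) (simp_all add: defs)
  show "inf x y \<le> x" by (cases x; cases y) (simp_all add: defs)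
  show "inf x y \<le> y" by (cases x; cases y) (simp_all add: defs)
  show "x \<le> inf y z" if "x \<le> y" "x \<le> z" using that by (cases x; cases y; cases z) (simp_all add: defs)
  show "x \<le> sup x y" by (cases x; cases y) (simp_all add: defs)
  show "y \<le> sup x y" by (cases x; cases y) (simp_all add: defs)
  show "sup y z \<le> x" if "y \<le> x" "z \<le> x" using that by (cases x; cases y; cases z) (simp_all add: defs)
  show "bot \<le> x" by (simp add: defs)
  show "x \<le> top" by (simp add: defs)
  show "sup x (inf y z) = inf (sup x y) (sup x z)" by (cases x; cases y; cases z) (simp_all add: defs)
  show "inf x (- x) = bot" by (cases x) (simp_all add: defs)
  show "sup x (- x) = top" by (cases x) (simp_all add: defs)
  show "x - y = inf x (- y)" by (simp add: minus_b2_def)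
qed

end

primrec delta :: "b2 \<Rightarrow> b2" where
  "delta Zero = Sigma"
| "delta Rho = Sigma"
| "delta Sigma = One"
| "delta One = One"

primrec eval :: "(nat \<Rightarrow> b2) \<Rightarrow> fm \<Rightarrow> b2" where
  "eval v (Var i) = v i"
| "eval v (Conj F G) = inf (eval v F) (eval v G)"
| "eval v (Disj F G) = sup (eval v F) (eval v G)"
| "eval v (Impl F G) = sup (- eval v F) (eval v G)"
| "eval v (Neg F) = - eval v F"
| "eval v (Delta F) = delta (eval v F)"

text \<open>
  An n-ary operation on the algebra is a function on lists, of which only the values on lists
  of length n matter. The variable \<open>Var i\<close> takes the value of the list entry with index i
  (counted from 0), so the formulas in the first n variables are those with
  \<open>vars F \<subseteq> {..<n}\<close>.
\<close>

definition induces :: "nat \<Rightarrow> fm \<Rightarrow> (b2 list \<Rightarrow> b2) \<Rightarrow> bool" where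
  "induces n F f \<longleftrightarrow>
     vars F \<subseteq> {..<n} \<and> (\<forall>as. length as = n \<longrightarrow> eval (\<lambda>i. as ! i) F = f as)"

definition preserves :: "nat \<Rightarrow> (b2 list \<Rightarrow> b2) \<Rightarrow> (b2 \<Rightarrow> b2 \<Rightarrow> bool) \<Rightarrow> bool" where
  "preserves n f R \<longleftrightarrow>
     (\<forall>as bs. length as = n \<longrightarrow> length bs = n \<longrightarrow>
        (\<forall>i<n. R (as ! i) (bs ! i)) \<longrightarrow> R (f as) (f bs))"

end

theory Submission imports Defs begin

text \<open>
  An element of the algebra is determined by two bits, namely whether it lies above the atom
  \<open>Rho\<close> and whether it lies above the atom \<open>Sigma\<close>. The Boolean operations act bitwise, and
  \<open>delta x\<close> has \<open>Sigma\<close>-bit 1 and the \<open>Sigma\<close>-bit of \<open>x\<close> as its \<open>Rho\<close>-bit. So the relation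
  \<open>delta x = delta y\<close> says that the \<open>Sigma\<close>-bits agree, and it is preserved by all formulas.
  Conversely, if \<open>f\<close> preserves it, the \<open>Sigma\<close>-bit of \<open>f\<close> is a Boolean function of the
  \<open>Sigma\<close>-bits of the arguments and is given by a disjunctive normal form in the variables. The
  \<open>Rho\<close>-bit of \<open>f\<close> is a Boolean function of all bits of the arguments and is given by a disjunctive
  normal form in the variables and their \<open>delta\<close>s. The two are glued along the constants
  \<open>Sigma = delta Zero\<close> and \<open>Rho = - Sigma\<close>.
\<close>

lemmas b2_defs = bot_b2_def top_b2_def less_eq_b2_def inf_b2_def sup_b2_def uminus_b2_def

text \<open>Every element is the join of the atoms below it. Quantifying over the two atoms lets
  later facts treat both bits at once.\<close>

lemma b2_eq_iff: "x = y \<longleftrightarrow> (\<forall>c\<in>{Rho, Sigma}. c \<le> x \<longleftrightarrow> c \<le> y)"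
  by (cases x; cases y) (simp_all add: b2_defs)

lemma atom_le_sup: "c \<in> {Rho, Sigma} \<Longrightarrow> c \<le> sup x y \<longleftrightarrow> c \<le> x \<or> c \<le> y"
  by (cases x; cases y) (auto simp: b2_defs)

lemma atom_le_uminus: "c \<in> {Rho, Sigma} \<Longrightarrow> c \<le> - x \<longleftrightarrow> \<not> c \<le> x"
  by (cases x) (auto simp: b2_defs)

lemma Rho_le_delta: "Rho \<le> delta x \<longleftrightarrow> Sigma \<le> x"
  by (cases x) (simp_all add: b2_defs)

lemma Sigma_le_delta: "Sigma \<le> delta x"
  by (cases x) (simp_all add: b2_defs)

lemma delta_eq_iff: "delta x = delta y \<longleftrightarrow> (Sigma \<le> x \<longleftrightarrow> Sigma \<le> y)"
  by (cases x; cases y) (simp_all add: b2_defs)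

lemma finite_b2_lists: "finite {as :: b2 list. length as = n}"
proof -
  have "x \<in> {Zero, Rho, Sigma, One}" for x
    by (cases x) simp_all
  then have "finite (UNIV :: b2 set)"
    by (intro finite_subset[of UNIV "{Zero, Rho, Sigma, One}"]) auto
  from finite_lists_length_eq[OF this] show ?thesis
    by simp
qed

text \<open>The Boolean connectives compute the \<open>Sigma\<close>-bit of a compound from the
  \<open>Sigma\<close>-bits of its parts, and under \<open>Delta\<close> this bit is constantly
  1.\<close>

lemma eval_delta_cong:
  assumes "\<forall>i\<in>vars F. delta (v i) = delta (w i)"
  shows "delta (eval v F) = delta (eval w F)"
  using assms by (induction F) (auto simp: delta_eq_iff Sigma_le_delta atom_le_sup atom_le_uminus)

definition definable :: "nat \<Rightarrow> (b2 list \<Rightarrow> b2) \<Rightarrow> bool" where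
  "definable n f \<longleftrightarrow> (\<exists>F. induces n F f)"

lemma definable_cong:
  assumes "definable n f" "\<And>as. length as = n \<Longrightarrow> f as = g as"
  shows "definable n g"
  using assms unfolding definable_def induces_def by auto

lemma definable_nth: "i < n \<Longrightarrow> definable n (\<lambda>as. as ! i)"
  unfolding definable_def induces_def by (intro exI[of _ "Var i"]) simp

lemma definable_inf: "definable n f \<Longrightarrow> definable n g \<Longrightarrow> definable n (\<lambda>as. inf (f as) (g as))"
  unfolding definable_def induces_def by (metis vars.simps(2) eval.simps(2) Un_least)

lemma definable_sup: "definable n f \<Longrightarrow> definable n g \<Longrightarrow> definable n (\<lambda>as. sup (f as) (g as))"
  unfolding definable_def induces_def by (metis vars.simps(3) eval.simps(3) Un_least)

lemma definable_uminus: "definable n f \<Longrightarrow> definable n (\<lambda>as. - f as)"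
  unfolding definable_def induces_def by (metis vars.simps(5) eval.simps(5))

lemma definable_delta: "definable n f \<Longrightarrow> definable n (\<lambda>as. delta (f as))"
  unfolding definable_def induces_def by (metis vars.simps(6) eval.simps(6))

text \<open>Formulas have no primitive constants, so zero is built as p & not p from the first
  variable; this is where \<open>n \<ge> 1\<close> enters.\<close>

lemma definable_Zero:
  assumes "n \<ge> 1"
  shows "definable n (\<lambda>_. Zero)"
proof -
  have "definable n (\<lambda>as. as ! 0)"
    using assms by (intro definable_nth) simp
  from definable_inf[OF this definable_uminus[OF this]] show ?thesis
    by (simp add: bot_b2_def)
qed

lemma definable_Sigma: "n \<ge> 1 \<Longrightarrow> definable n (\<lambda>_. Sigma)"
  using definable_delta[OF definable_Zero] by simp

lemma definable_Rho: "n \<ge> 1 \<Longrightarrow> definable n (\<lambda>_. Rho)"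
  using definable_uminus[OF definable_Sigma] by (simp add: uminus_b2_def)

lemma definable_finite_disj:
  assumes "n \<ge> 1" "finite A" "\<forall>a\<in>A. definable n (g a)"
  obtains h where "definable n h"
    "\<forall>as. \<forall>c\<in>{Rho, Sigma}. c \<le> h as \<longleftrightarrow> (\<exists>a\<in>A. c \<le> g a as)"
  using assms(2,3)
proof (induction A arbitrary: thesis rule: finite_induct)
  case empty
  show ?case
    using definable_Zero[OF assms(1)] by (rule empty.prems(1)) (auto simp: less_eq_b2_def)
next
  case (insert a A)
  obtain h where h: "definable n h"
    "\<forall>as. \<forall>c\<in>{Rho, Sigma}. c \<le> h as \<longleftrightarrow> (\<exists>a\<in>A. c \<le> g a as)"
    by (rule insert.IH) (use insert.prems(2) in auto)
  have "definable n (\<lambda>as. sup (g a as) (h as))"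
    using insert.prems(2) h(1) by (intro definable_sup) auto
  then show ?case
    by (rule insert.prems(1)) (simp add: atom_le_sup h(2))
qed

text \<open>De Morgan dual of the disjunction.\<close>

lemma definable_finite_conj:
  assumes "n \<ge> 1" "finite A" "\<forall>a\<in>A. definable n (g a)"
  obtains h where "definable n h"
    "\<forall>as. \<forall>c\<in>{Rho, Sigma}. c \<le> h as \<longleftrightarrow> (\<forall>a\<in>A. c \<le> g a as)"
proof -
  have "\<forall>a\<in>A. definable n (\<lambda>as. - g a as)"
    using assms(3) definable_uminus by blast
  then obtain h where h: "definable n h"
    "\<forall>as. \<forall>c\<in>{Rho, Sigma}. c \<le> h as \<longleftrightarrow> (\<exists>a\<in>A. c \<le> - g a as)"
    by (rule definable_finite_disj[OF assms(1,2)]) (rule that)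
  show ?thesis
    using definable_uminus[OF h(1)] by (rule that) (simp add: atom_le_uminus h(2))
qed

definition literal :: "bool \<Rightarrow> b2 \<Rightarrow> b2" where
  "literal b x = (if b then x else - x)"

lemma atom_le_literal: "c \<in> {Rho, Sigma} \<Longrightarrow> c \<le> literal b x \<longleftrightarrow> (c \<le> x \<longleftrightarrow> b)"
  by (simp add: literal_def atom_le_uminus)

lemma definable_literal: "definable n f \<Longrightarrow> definable n (\<lambda>as. literal b (f as))"
  by (cases b) (simp_all add: literal_def definable_uminus)

text \<open>At \<open>Rho\<close> a variable shows its own \<open>Rho\<close>-bit and its
  \<open>delta\<close> shows its \<open>Sigma\<close>-bit, so a minterm over both singles out one
  list.\<close>

lemma definable_Rho_indicator:
  assumes "n \<ge> 1" "length a = n"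
  shows "\<exists>h. definable n h \<and> (\<forall>as. length as = n \<longrightarrow> (Rho \<le> h as \<longleftrightarrow> as = a))"
proof -
  define g where "g i as = inf (literal (Rho \<le> a ! i) (as ! i))
    (literal (Sigma \<le> a ! i) (delta (as ! i)))" for i as
  have "\<forall>i\<in>{..<n}. definable n (g i)"
    unfolding g_def by (auto intro!: definable_inf definable_literal definable_delta definable_nth)
  then obtain h where h: "definable n h"
    "\<forall>as. \<forall>c\<in>{Rho, Sigma}. c \<le> h as \<longleftrightarrow> (\<forall>i\<in>{..<n}. c \<le> g i as)"
    by (rule definable_finite_conj[OF assms(1) finite_lessThan]) (rule that)
  have "Rho \<le> g i as \<longleftrightarrow> as ! i = a ! i" for i as
    by (auto simp: g_def atom_le_literal Rho_le_delta b2_eq_iff[of "as ! i"])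
  with h(1) assms(2) show ?thesis
    by (intro exI[of _ h]) (auto simp: h(2) list_eq_iff_nth_eq)
qed

text \<open>At \<open>Sigma\<close> every \<open>delta\<close> is constantly 1 and distinguishes
  nothing, so the minterm uses the variables alone and isolates only the class of \<open>a\<close>
  modulo equality of \<open>delta\<close>.\<close>

lemma definable_Sigma_indicator:
  assumes "n \<ge> 1"
  shows "\<exists>h. definable n h \<and> (\<forall>as. Sigma \<le> h as \<longleftrightarrow> (\<forall>i<n. delta (as ! i) = delta (a ! i)))"
proof -
  define g where "g i as = literal (Sigma \<le> a ! i) (as ! i)" for i :: nat and as
  have "\<forall>i\<in>{..<n}. definable n (g i)"
    unfolding g_def by (auto intro!: definable_literal definable_nth)
  then obtain h where h: "definable n h"
    "\<forall>as. \<forall>c\<in>{Rho, Sigma}. c \<le> h as \<longleftrightarrow> (\<forall>i\<in>{..<n}. c \<le> g i as)"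
    by (rule definable_finite_conj[OF assms(1) finite_lessThan]) (rule that)
  from h(1) show ?thesis
    by (intro exI[of _ h]) (auto simp: h(2) g_def atom_le_literal delta_eq_iff)
qed

lemma definable_Rho_part:
  assumes "n \<ge> 1"
  shows "\<exists>h. definable n h \<and> (\<forall>as. length as = n \<longrightarrow> (Rho \<le> h as \<longleftrightarrow> Rho \<le> f as))"
proof -
  have "\<forall>a. length a = n \<longrightarrow>
      (\<exists>h. definable n h \<and> (\<forall>as. length as = n \<longrightarrow> (Rho \<le> h as \<longleftrightarrow> as = a)))"
    using definable_Rho_indicator[OF assms] by blast
  then obtain g where g: "\<And>a. length a = n \<Longrightarrow> definable n (g a)"
    "\<And>a as. length a = n \<Longrightarrow> length as = n \<Longrightarrow> Rho \<le> g a as \<longleftrightarrow> as = a"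
    by metis
  \<comment> \<open>Disjunctive normal form: one minterm for each list where the
    \<open>Rho\<close>-bit of \<open>f\<close> is 1.\<close>
  define A where "A = {a. length a = n \<and> Rho \<le> f a}"
  have "finite A"
    using finite_b2_lists[of n] by (rule rev_finite_subset) (auto simp: A_def)
  moreover have "\<forall>a\<in>A. definable n (g a)"
    using g(1) by (simp add: A_def)
  ultimately obtain h where h: "definable n h"
    "\<forall>as. \<forall>c\<in>{Rho, Sigma}. c \<le> h as \<longleftrightarrow> (\<exists>a\<in>A. c \<le> g a as)"
    by (rule definable_finite_disj[OF assms]) (rule that)
  from h(1) show ?thesis
    by (intro exI[of _ h]) (auto simp: A_def g(2) h(2))
qed

text \<open>Each disjunct holds on a whole class of lists with equal \<open>delta\<close>s.
  Preservation makes the \<open>Sigma\<close>-bit of \<open>f\<close> constant on such a class, so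
  no disjunct covers too much.\<close>

lemma definable_Sigma_part:
  assumes "n \<ge> 1" "preserves n f (\<lambda>x y. delta x = delta y)"
  shows "\<exists>h. definable n h \<and> (\<forall>as. length as = n \<longrightarrow> (Sigma \<le> h as \<longleftrightarrow> Sigma \<le> f as))"
proof -
  from definable_Sigma_indicator[OF assms(1)] obtain g where g: "\<And>a. definable n (g a)"
    "\<And>a as. Sigma \<le> g a as \<longleftrightarrow> (\<forall>i<n. delta (as ! i) = delta (a ! i))"
    by metis
  define A where "A = {a. length a = n \<and> Sigma \<le> f a}"
  have "finite A"
    using finite_b2_lists[of n] by (rule rev_finite_subset) (auto simp: A_def)
  moreover have "\<forall>a\<in>A. definable n (g a)"
    using g(1) by simp
  ultimately obtain h where h: "definable n h"
    "\<forall>as. \<forall>c\<in>{Rho, Sigma}. c \<le> h as \<longleftrightarrow> (\<exists>a\<in>A. c \<le> g a as)"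
    by (rule definable_finite_disj[OF assms(1)]) (rule that)
  have "Sigma \<le> h as \<longleftrightarrow> Sigma \<le> f as" if "length as = n" for as
  proof
    assume "Sigma \<le> h as"
    then obtain a where "length a = n" "Sigma \<le> f a" "\<forall>i<n. delta (as ! i) = delta (a ! i)"
      by (auto simp: h(2) g(2) A_def)
    then have "delta (f as) = delta (f a)"
      using assms(2) that unfolding preserves_def by blast
    with \<open>Sigma \<le> f a\<close> show "Sigma \<le> f as"
      by (simp add: delta_eq_iff)
  next
    \<comment> \<open>Here \<open>as\<close> itself belongs to \<open>A\<close> and satisfies its
      own disjunct.\<close>
    assume "Sigma \<le> f as"
    with that show "Sigma \<le> h as"
      by (auto simp: h(2) g(2) A_def)
  qed
  with h(1) show ?thesis
    by blast
qed

theorem theorem1: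
  fixes n :: nat and f :: "b2 list \<Rightarrow> b2"
  assumes "n \<ge> 1"
  shows "(\<exists>F. induces n F f) \<longleftrightarrow> preserves n f (\<lambda>x y. delta x = delta y)"
proof
  assume "\<exists>F. induces n F f"
  then obtain F where F: "vars F \<subseteq> {..<n}"
    "\<And>as. length as = n \<Longrightarrow> eval (\<lambda>i. as ! i) F = f as"
    by (auto simp: induces_def)
  show "preserves n f (\<lambda>x y. delta x = delta y)"
    unfolding preserves_def
  proof (intro allI impI)
    fix as bs :: "b2 list"
    assume *: "length as = n" "length bs = n" "\<forall>i<n. delta (as ! i) = delta (bs ! i)"
    \<comment> \<open>The bound on \<open>vars F\<close> ensures that only entries with index below
      \<open>n\<close> are compared.\<close>
    have "delta (eval (\<lambda>i. as ! i) F) = delta (eval (\<lambda>i. bs ! i) F)"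
      using F(1) *(3) by (intro eval_delta_cong) auto
    then show "delta (f as) = delta (f bs)"
      using F(2) * by simp
  qed
next
  assume pres: "preserves n f (\<lambda>x y. delta x = delta y)"
  obtain h where h: "definable n h" "\<And>as. length as = n \<Longrightarrow> Rho \<le> h as \<longleftrightarrow> Rho \<le> f as"
    using definable_Rho_part[OF assms] by blast
  obtain k where k: "definable n k" "\<And>as. length as = n \<Longrightarrow> Sigma \<le> k as \<longleftrightarrow> Sigma \<le> f as"
    using definable_Sigma_part[OF assms pres] by blast
  have "definable n (\<lambda>as. sup (inf Rho (h as)) (inf Sigma (k as)))"
    by (intro definable_sup definable_inf definable_Rho definable_Sigma assms h(1) k(1))
  moreover have "sup (inf Rho (h as)) (inf Sigma (k as)) = f as" if "length as = n" for as
  proof -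
    \<comment> \<open>As the atoms are incomparable, meeting with one erases the other bit:
      \<open>h\<close> contributes only at \<open>Rho\<close> and \<open>k\<close> only at
      \<open>Sigma\<close>.\<close>
    have "\<not> Rho \<le> Sigma" "\<not> Sigma \<le> Rho"
      by (simp_all add: less_eq_b2_def)
    with h(2)[OF that] k(2)[OF that] show ?thesis
      by (simp add: b2_eq_iff[of _ "f as"] atom_le_sup)
  qed
  ultimately have "definable n f"
    by (rule definable_cong)
  then show "\<exists>F. induces n F f"
    by (simp add: definable_def)
qed

end
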